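(* Let $G_1,\dots,G_m$ ($m\ge1$) be $1$-dimensional finite abstract simplicial complexes and let $L$ be the connection Laplacian of the product $G_1\times\cdots\times G_m$. Then the functional equation holds: $\zeta_{L^2}(-s)=\zeta_{L^2}(s)$ for all $s\in\mathbb{C}$, where $\zeta_{L^2}(s)=\sum_k\lambda_k^{-s}$ is the sum over the eigenvalues $\lambda_k$ of $L^2$ counted with multiplicity.
   Context: A finite abstract simplicial complex $G$ is a finite set of non-empty finite sets (simplices) closed under taking non-empty subsets; it is $1$-dimensional if every $x\in G$ has $|x|\le2$ and at least one $x\in G$ has $|x|=2$. The product $G_1\times\cdots\times G_m$ (in the strong ring) is the Cartesian product set, and its connection Laplacian $L$ is the matrix indexed by this set with $L((x_1,\dots,x_m),(y_1,\dots,y_m))=1$ if $x_j\cap y_j\ne\emptyset$ for all $j=1,\dots,m$, and $0$ otherwise. It is symmetric and known to be invertible, so $L^2$ is positive definite; powers use the real logarithm. *)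

theory Defs
  imports
    "HOL-Analysis.Analysis"
    "Jordan_Normal_Form.Char_Poly"
begin

definition finite_simplicial_complex :: "'v set set \<Rightarrow> bool" where
  "finite_simplicial_complex G \<longleftrightarrow>
     finite G \<and> (\<forall>x\<in>G. finite x \<and> x \<noteq> {}) \<and> (\<forall>x\<in>G. \<forall>y. y \<subseteq> x \<and> y \<noteq> {} \<longrightarrow> y \<in> G)"

definition one_dimensional :: "'v set set \<Rightarrow> bool" where
  "one_dimensional G \<longleftrightarrow> (\<forall>x\<in>G. card x \<le> 2) \<and> (\<exists>x\<in>G. card x = 2)"

text \<open>An element \<open>(x\<^sub>1, \<dots>, x\<^sub>m)\<close> of the product is the extensional function \<open>j \<mapsto> x\<^sub>j\<close> on \<open>{1..m}\<close>.\<close>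

definition complex_product :: "nat \<Rightarrow> (nat \<Rightarrow> 'v set set) \<Rightarrow> (nat \<Rightarrow> 'v set) set" where
  "complex_product m G = (\<Pi>\<^sub>E j\<in>{1..m}. G j)"

text \<open>
  Matrices have index set \<open>{0..<n}\<close>, so a matrix indexed by the product is written with respect
  to a list \<open>xs\<close> enumerating the product without repetition.
\<close>

definition connection_laplacian :: "nat \<Rightarrow> (nat \<Rightarrow> 'v set) list \<Rightarrow> real mat" where
  "connection_laplacian m xs = mat (length xs) (length xs)
     (\<lambda>(a, b). if \<forall>j\<in>{1..m}. (xs ! a) j \<inter> (xs ! b) j \<noteq> {} then 1 else 0)"

text \<open>
  Meant for symmetric positive definite \<open>A\<close>: then all complex eigenvalues are real, algebraic and
  geometric multiplicities agree, and \<open>powr\<close> at a positive real \<open>k\<close> is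
  \<open>exp (- s * of_real (ln k))\<close>.
\<close>

definition spectral_zeta :: "real mat \<Rightarrow> complex \<Rightarrow> complex" where
  "spectral_zeta A s =
     (\<Sum>k | eigenvalue A k. of_nat (Polynomial.order k (char_poly A)) * complex_of_real k powr (- s))"

end

theory Submission
  imports Defs "HOL-Library.Function_Algebras"
begin

text \<open>
  The functional equation says that the spectrum of \<open>L\<^sup>2\<close> is invariant under \<open>k \<mapsto> 1/k\<close>, with
  multiplicities. Since \<open>char_poly L\<^sup>-\<^sup>2\<close> is a scalar multiple of the reflected polynomial of
  \<open>char_poly L\<^sup>2\<close> (\<open>char_poly_inverse\<close>), this amounts to \<open>char_poly L\<^sup>2 = char_poly L\<^sup>-\<^sup>2\<close>. The
  eigenvalues of \<open>L\<^sup>2\<close> are positive because \<open>L\<close> is symmetric and invertible, so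
  \<open>(1/k) powr - s = k powr s\<close> for each of them (\<open>spectral_zeta_functional_equation\<close>).

  For a single complex, let \<open>B\<close> be the incidence matrix of vertices in edges, extended by zero to
  all simplices, let \<open>C\<close> be its transpose, and let \<open>S\<close> be \<open>1\<close> on vertices and \<open>-1\<close> on edges. Two edges
  share as many vertices as they have common proper faces, which gives \<open>L = S + B + C + C B\<close>. From
  \<open>S\<^sup>2 = 1\<close>, \<open>B\<^sup>2 = C\<^sup>2 = 0\<close> and the commutation of \<open>S\<close> with \<open>B\<close> and \<open>C\<close> up to sign one reads off
  the inverse \<open>N = S + B + C - B C\<close>. With \<open>J = B - C\<close> one has \<open>N = L + J\<^sup>2\<close> and \<open>L J = - J N\<close>, so
  \<open>L\<^sup>2 = 1 + (J N) J\<close> whereas \<open>N\<^sup>2 = 1 + J (J N)\<close>: the two squares have the form \<open>1 + u v\<close> and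
  \<open>1 + v u\<close> (\<open>connection_relations\<close>). Sylvester's identity for \<open>u v\<close> and \<open>v u\<close> settles the case of
  one factor.

  The connection matrix of a product is the Kronecker product of the connection matrices of the
  factors, and so are its square and its inverse. The factors \<open>1 + u v\<close> of its square are replaced by
  \<open>1 + v u\<close> one at a time, each replacement preserving the characteristic polynomial.
  Expanding the Kronecker product in the factor at hand yields
  \<open>X + u' v'\<close> and \<open>X + v' u'\<close>, where \<open>v'\<close> acts on that factor only and \<open>X\<close> acts trivially on it, so
  \<open>v'\<close> and \<open>X\<close> commute. That is what the version of Sylvester's identity in
  \<open>char_poly_add_mult_commute\<close> asks for.
\<close>

section \<open>Sylvester's identity relative to a commuting matrix\<close>

text \<open>
  For \<open>R = 1\<close> this is Sylvester's identity. Both sides are, up to the same sign, the determinant of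
  the block matrix with rows \<open>(U, R)\<close> and \<open>(1, V)\<close>: its bottom blocks commute, and in the
  transpose the bottom blocks are \<open>R\<^sup>T\<close> and \<open>V\<^sup>T\<close>, which commute by assumption.
\<close>

lemma det_minus_mult_commute:
  fixes R U V :: "'a::idom mat"
  assumes R: "R \<in> carrier_mat n n" and U: "U \<in> carrier_mat n n" and V: "V \<in> carrier_mat n n"
    and comm: "V * R = R * V"
  shows "det (R - U * V) = det (R - V * U)"
proof -
  let ?M = "four_block_mat U R (1\<^sub>m n) V"
  have T: "R\<^sup>T \<in> carrier_mat n n" "U\<^sup>T \<in> carrier_mat n n" "V\<^sup>T \<in> carrier_mat n n"
    using R U V by auto
  have neg: "det (X - Y) = (-1) ^ n * det (Y - X)"
    if "X \<in> carrier_mat n n" "Y \<in> carrier_mat n n" for X Y :: "'a mat"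
  proof -
    have "X - Y = (-1) \<cdot>\<^sub>m (Y - X)" using that by (intro eq_matI) auto
    then show ?thesis using that by simp
  qed
  have "det ?M = det (U * V - R)"
    using det_four_block_mat[OF U R one_carrier_mat V] R V by simp
  moreover have "det ?M = det (V * U - R)"
  proof -
    have "det ?M = det (four_block_mat U\<^sup>T (1\<^sub>m n) R\<^sup>T V\<^sup>T)"
      using det_transpose[OF four_block_carrier_mat[OF U V], of R "1\<^sub>m n"]
        transpose_four_block_mat[OF U R one_carrier_mat V] by simp
    also have "\<dots> = det (U\<^sup>T * V\<^sup>T - R\<^sup>T)"
      using det_four_block_mat[OF T(2) one_carrier_mat T(1,3)] T
        transpose_mult[OF V R] transpose_mult[OF R V] comm by simp
    also have "\<dots> = det ((V * U - R)\<^sup>T)"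
      using transpose_mult[OF V U] transpose_minus[OF mult_carrier_mat[OF V U] R] by simp
    also have "\<dots> = det (V * U - R)"
      using U V R by (intro det_transpose) auto
    finally show ?thesis .
  qed
  ultimately show ?thesis using neg[OF R mult_carrier_mat[OF U V]] neg[OF R mult_carrier_mat[OF V U]]
    by simp
qed

lemma poly_char_poly:
  fixes A :: "'a::field mat"
  assumes "A \<in> carrier_mat n n"
  shows "poly (char_poly A) x = det (x \<cdot>\<^sub>m 1\<^sub>m n - A)"
proof -
  have "- char_matrix A x = x \<cdot>\<^sub>m 1\<^sub>m n - A"
    using assms by (intro eq_matI) (auto simp: char_matrix_def)
  then show ?thesis using char_poly_matrix[OF assms] by simp
qed

lemma char_poly_add_mult_commute:
  fixes C U V :: "'a::field_char_0 mat"
  assumes C: "C \<in> carrier_mat n n" and U: "U \<in> carrier_mat n n" and V: "V \<in> carrier_mat n n"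
    and comm: "V * C = C * V"
  shows "char_poly (C + U * V) = char_poly (C + V * U)"
proof -
  have "poly (char_poly (C + U * V)) x = poly (char_poly (C + V * U)) x" for x
  proof -
    let ?R = "x \<cdot>\<^sub>m 1\<^sub>m n - C"
    have R: "?R \<in> carrier_mat n n" using C by auto
    have "V * ?R = x \<cdot>\<^sub>m V - V * C"
      using C V
      by (simp add: mult_minus_distrib_mat[of _ n n _ n] mult_smult_distrib[of V n n _ n])
    moreover have "?R * V = x \<cdot>\<^sub>m V - C * V"
      using C V
      by (simp add: minus_mult_distrib_mat[of _ n n _ _ n] mult_smult_assoc_mat[of _ n n V n])
    ultimately have "V * ?R = ?R * V" using comm by simp
    from det_minus_mult_commute[OF R U V this]
    have "det (?R - U * V) = det (?R - V * U)" .
    moreover have "?R - X = x \<cdot>\<^sub>m 1\<^sub>m n - (C + X)" if "X \<in> carrier_mat n n" for X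
      using C that by (intro eq_matI) auto
    ultimately show ?thesis
      using C U V by (simp add: poly_char_poly[of _ n])
  qed
  then show ?thesis by (simp flip: poly_eq_poly_eq_iff add: fun_eq_iff)
qed

section \<open>Matrices whose inverse has the same characteristic polynomial\<close>

lemma order_reflect_poly:
  fixes p :: "'a::field poly"
  assumes "p \<noteq> 0" and "k \<noteq> 0"
  shows "Polynomial.order (inverse k) (reflect_poly p) = Polynomial.order k p"
proof -
  obtain q where p: "p = [:-k, 1:] ^ Polynomial.order k p * q" and q: "\<not> [:-k, 1:] dvd q"
    using order_decomp[OF assms(1)] by blast
  have "reflect_poly [:-k, 1:] = Polynomial.smult (-k) [:- inverse k, 1:]"
    using assms(2) by (simp add: reflect_poly_pCons)
  then have "reflect_poly p = Polynomial.smult ((-k) ^ Polynomial.order k p)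
      ([:- inverse k, 1:] ^ Polynomial.order k p * reflect_poly q)"
    by (subst p) (simp only: reflect_poly_mult reflect_poly_power smult_power mult_smult_left)
  moreover have "q \<noteq> 0" using q by auto
  moreover have "Polynomial.order (inverse k) (reflect_poly q) = 0"
    using q assms(2) by (intro order_0I) (simp add: poly_reflect_poly_nz poly_eq_0_iff_dvd)
  ultimately show ?thesis using assms(2)
    by (simp add: order_smult order_mult order_power_n_n del: power_minus_odd)
qed

text \<open>
  For \<open>x \<noteq> 0\<close> the identity \<open>A (x - N) = - x (1/x - A)\<close> compares the two determinants. Agreement
  off \<open>0\<close> is enough for polynomials over an infinite field.
\<close>

lemma char_poly_inverse:
  fixes A N :: "'a::field_char_0 mat"
  assumes A: "A \<in> carrier_mat n n" and N: "N \<in> carrier_mat n n" and AN: "A * N = 1\<^sub>m n"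
  shows "Polynomial.smult (det A) (char_poly N)
    = Polynomial.smult ((-1) ^ n) (reflect_poly (char_poly A))"
    (is "?l = ?r")
proof (rule ccontr)
  have eq: "poly ?l x = poly ?r x" if "x \<noteq> 0" for x
  proof -
    have "poly ?l x = det (A * (x \<cdot>\<^sub>m 1\<^sub>m n - N))"
      using A N by (simp add: poly_char_poly det_mult[OF A minus_carrier_mat])
    also have "A * (x \<cdot>\<^sub>m 1\<^sub>m n - N) = (- x) \<cdot>\<^sub>m (inverse x \<cdot>\<^sub>m 1\<^sub>m n - A)"
    proof -
      have "A * (x \<cdot>\<^sub>m 1\<^sub>m n - N) = x \<cdot>\<^sub>m A - 1\<^sub>m n"
        using A N AN
        by (simp add: mult_minus_distrib_mat[of _ n n _ n] mult_smult_distrib[of A n n _ n])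
      also have "\<dots> = (- x) \<cdot>\<^sub>m (inverse x \<cdot>\<^sub>m 1\<^sub>m n - A)"
        using A that by (intro eq_matI) (auto simp: field_simps)
      finally show ?thesis .
    qed
    also have "det \<dots> = (- x) ^ n * poly (char_poly A) (inverse x)"
      using A by (simp add: poly_char_poly[of _ n])
    also have "\<dots> = poly ?r x"
      using degree_monic_char_poly[OF A] that
      by (simp add: poly_reflect_poly_nz power_minus[of x])
    finally show ?thesis .
  qed
  assume "?l \<noteq> ?r"
  then have "finite {x. poly (?l - ?r) x = 0}" by (intro poly_roots_finite) simp
  moreover have "UNIV - {0} \<subseteq> {x. poly (?l - ?r) x = 0}" using eq by auto
  ultimately have "finite (UNIV - {0} :: 'a set)" by (rule rev_finite_subset)
  then show False using infinite_UNIV_char_0[where 'a='a] by simp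
qed

text \<open>
  A reciprocal characteristic polynomial gives \<open>k\<close> and \<open>1/k\<close> the same multiplicity, so inversion
  permutes the terms of the sum. Positivity of the eigenvalues keeps the complex power away from
  the branch cut, where \<open>Ln (1/k) = - Ln k\<close> would fail.
\<close>

lemma spectral_zeta_functional_equation:
  assumes A: "A \<in> carrier_mat n n" and N: "N \<in> carrier_mat n n" and AN: "A * N = 1\<^sub>m n"
    and char: "char_poly A = char_poly N"
    and pos: "\<And>k. eigenvalue A k \<Longrightarrow> 0 < k"
  shows "spectral_zeta A (- s) = spectral_zeta A s"
proof -
  let ?p = "char_poly A"
  have p: "?p \<noteq> 0" using degree_monic_char_poly[OF A] by auto
  have "det A \<noteq> 0" using det_mult[OF A N] AN by auto
  have ord: "Polynomial.order (inverse k) ?p = Polynomial.order k ?p" if "k \<noteq> 0" for k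
  proof -
    have "Polynomial.order (inverse k) ?p
        = Polynomial.order (inverse k) (Polynomial.smult (det A) (char_poly N))"
      using \<open>det A \<noteq> 0\<close> by (simp add: char order_smult)
    also have "\<dots> = Polynomial.order (inverse k) (reflect_poly ?p)"
      unfolding char_poly_inverse[OF A N AN] by (simp add: order_smult)
    also have "\<dots> = Polynomial.order k ?p" by (rule order_reflect_poly[OF p that])
    finally show ?thesis .
  qed
  have inv: "eigenvalue A (inverse k)" if "eigenvalue A k" for k
    using that ord[of k] pos[of k] p
    by (auto simp: eigenvalue_root_char_poly[OF A] order_root)
  show ?thesis unfolding spectral_zeta_def
  proof (rule sum.reindex_bij_witness[of _ inverse inverse])
    fix k assume "k \<in> {k. eigenvalue A k}"
    then have k: "eigenvalue A k" "0 < k" using pos by auto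
    show "of_nat (Polynomial.order (inverse k) ?p) * complex_of_real (inverse k) powr - s
       = of_nat (Polynomial.order k ?p) * complex_of_real k powr - (- s)"
      using k by (simp add: ord powr_def Ln_of_real ln_inverse flip: of_real_inverse)
  qed (auto intro: inv)
qed

text \<open>
  If \<open>L\<^sup>2 v = k v\<close>, then symmetry gives \<open>(L v) \<bullet> (L v) = k (v \<bullet> v)\<close>, and \<open>L v \<noteq> 0\<close>.
\<close>

lemma eigenvalue_square_pos:
  fixes L :: "real mat"
  assumes L: "L \<in> carrier_mat n n" and sym: "L\<^sup>T = L" and det: "det L \<noteq> 0"
    and ev: "eigenvalue (L * L) k"
  shows "0 < k"
proof -
  obtain v where v: "v \<in> carrier_vec n" "v \<noteq> 0\<^sub>v n" "L * L *\<^sub>v v = k \<cdot>\<^sub>v v"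
    using ev L unfolding eigenvalue_def eigenvector_def by auto
  define w where "w = L *\<^sub>v v"
  have w: "w \<in> carrier_vec n" using L v by (simp add: w_def)
  have conj: "conjugate u = u" for u :: "real vec"
    by (intro eq_vecI) auto
  have "w \<noteq> 0\<^sub>v n"
    using det det_0_iff_vec_prod_zero[OF L] v unfolding w_def by auto
  then have "0 < w \<bullet> w" using conjugate_square_greater_0_vec[OF w] by (simp add: conj)
  also have "w \<bullet> w = v \<bullet> (L *\<^sub>v w)"
    using transpose_vec_mult_scalar[OF L v(1) w] sym
      comm_scalar_prod[OF v(1), of "L *\<^sub>v w"] L w by (simp add: w_def)
  also have "\<dots> = k * (v \<bullet> v)"
    using v L by (simp add: w_def flip: assoc_mult_mat_vec)
  finally have "0 < k * (v \<bullet> v)" .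
  moreover have "0 < v \<bullet> v" using conjugate_square_greater_0_vec[OF v(1)] v(2) by (simp add: conj)
  ultimately show ?thesis by (simp add: zero_less_mult_iff)
qed

section \<open>Matrices indexed by a finite set\<close>

text \<open>
  Matrices over an arbitrary index type are functions of two arguments. They carry the pointwise
  additive structure of functions, so that only the product over a finite index set \<open>I\<close> has to be
  introduced. The unit \<open>munit I\<close> vanishes outside \<open>I\<close>. With this convention the relations between
  the matrices of a complex hold as equations between functions and can be used for rewriting.
\<close>

definition mmul :: "'i set \<Rightarrow> ('i \<Rightarrow> 'i \<Rightarrow> 'a::comm_ring_1) \<Rightarrow> ('i \<Rightarrow> 'i \<Rightarrow> 'a) \<Rightarrow> 'i \<Rightarrow> 'i \<Rightarrow> 'a"
  where "mmul I f g = (\<lambda>x y. \<Sum>z\<in>I. f x z * g z y)"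

definition munit :: "'i set \<Rightarrow> 'i \<Rightarrow> 'i \<Rightarrow> 'a::comm_ring_1"
  where "munit I = (\<lambda>x y. if x = y \<and> x \<in> I then 1 else 0)"

lemma mmul_assoc: "mmul I (mmul I f g) h = mmul I f (mmul I g h)"
proof (intro ext)
  fix x y
  show "mmul I (mmul I f g) h x y = mmul I f (mmul I g h) x y"
    unfolding mmul_def sum_distrib_left sum_distrib_right
    by (subst sum.swap) (simp add: mult.assoc)
qed

lemma mmul_linear:
  "mmul I (f + g) h = mmul I f h + mmul I g h"
  "mmul I f (g + h) = mmul I f g + mmul I f h"
  "mmul I (f - g) h = mmul I f h - mmul I g h"
  "mmul I f (g - h) = mmul I f g - mmul I f h"
  "mmul I (- f) h = - mmul I f h"
  "mmul I f (- h) = - mmul I f h"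
  "mmul I 0 f = 0"
  "mmul I f 0 = 0"
  by (auto simp: mmul_def fun_eq_iff algebra_simps sum.distrib sum_subtractf sum_negf)

lemma mmul_munit:
  assumes "finite I"
  shows "x \<in> I \<Longrightarrow> mmul I (munit I) f x y = f x y"
    and "y \<in> I \<Longrightarrow> mmul I f (munit I) x y = f x y"
proof -
  assume "x \<in> I"
  have "mmul I (munit I) f x y = (\<Sum>z\<in>I. if z = x then f z y else 0)"
    unfolding mmul_def munit_def by (rule sum.cong) auto
  then show "mmul I (munit I) f x y = f x y" using assms \<open>x \<in> I\<close> by simp
next
  assume "y \<in> I"
  have "mmul I f (munit I) x y = (\<Sum>z\<in>I. if z = y then f x z else 0)"
    unfolding mmul_def munit_def by (rule sum.cong) auto
  then show "mmul I f (munit I) x y = f x y" using assms \<open>y \<in> I\<close> by simp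
qed

section \<open>Kronecker products of families of matrices\<close>

definition kron :: "'j set \<Rightarrow> ('j \<Rightarrow> 'i) list \<Rightarrow> ('j \<Rightarrow> 'i \<Rightarrow> 'i \<Rightarrow> 'a::comm_ring_1) \<Rightarrow> 'a mat"
  where "kron J xs F = mat (length xs) (length xs) (\<lambda>(a, b). \<Prod>j\<in>J. F j ((xs ! a) j) ((xs ! b) j))"

lemma kron_carrier [simp]: "kron J xs F \<in> carrier_mat (length xs) (length xs)"
  by (simp add: kron_def)

locale finite_product =
  fixes J :: "'j set" and I :: "'j \<Rightarrow> 'i set" and xs :: "('j \<Rightarrow> 'i) list"
  assumes finJ: "finite J" and finI: "\<And>j. j \<in> J \<Longrightarrow> finite (I j)"
    and xs: "distinct xs" "set xs = Pi\<^sub>E J I"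
begin

lemma nth_component_in: "a < length xs \<Longrightarrow> j \<in> J \<Longrightarrow> (xs ! a) j \<in> I j"
  using xs(2) nth_mem[of a xs] by (auto simp: PiE_iff)

lemma kron_cong:
  assumes "\<And>j x y. j \<in> J \<Longrightarrow> x \<in> I j \<Longrightarrow> y \<in> I j \<Longrightarrow> F j x y = F' j x y"
  shows "kron J xs F = kron J xs F'"
  unfolding kron_def by (intro cong_mat) (auto intro!: prod.cong assms nth_component_in)

lemma kron_munit: "kron J xs (\<lambda>j. munit (I j)) = (1\<^sub>m (length xs) :: 'a::comm_ring_1 mat)"
proof (rule eq_matI)
  fix a b assume ab: "a < dim_row (1\<^sub>m (length xs))" "b < dim_col (1\<^sub>m (length xs))"
  then have ab: "a < length xs" "b < length xs" by auto
  have eq: "a = b" if "\<And>j. j \<in> J \<Longrightarrow> (xs ! a) j = (xs ! b) j"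
    using PiE_ext[of "xs ! a" J I "xs ! b"] that ab xs nth_mem[of a xs] nth_mem[of b xs]
    by (simp add: nth_eq_iff_index_eq)
  have "(\<Prod>j\<in>J. munit (I j) ((xs ! a) j) ((xs ! b) j)) = (if a = b then 1 else (0::'a))"
  proof (cases "a = b")
    case True
    then show ?thesis using nth_component_in ab by (simp add: munit_def)
  next
    case False
    then obtain j where "j \<in> J" "(xs ! a) j \<noteq> (xs ! b) j" using eq by blast
    then show ?thesis using finJ False by (auto intro!: prod_zero bexI[of _ j] simp: munit_def)
  qed
  then show "kron J xs (\<lambda>j. munit (I j)) $$ (a, b) = (1\<^sub>m (length xs) :: 'a mat) $$ (a, b)"
    using ab by (simp add: kron_def)
qed (auto simp: kron_def)

text \<open>
  The sum over the product index set factors, because a product of sums over the \<open>I j\<close> expands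
  into a sum over the choice functions.
\<close>

lemma kron_mult: "kron J xs F * kron J xs F' = kron J xs (\<lambda>j. mmul (I j) (F j) (F' j))"
proof (rule eq_matI)
  fix a b assume "a < dim_row (kron J xs (\<lambda>j. mmul (I j) (F j) (F' j)))"
    "b < dim_col (kron J xs (\<lambda>j. mmul (I j) (F j) (F' j)))"
  then have ab: "a < length xs" "b < length xs" by (auto simp: kron_def)
  let ?x = "xs ! a" and ?y = "xs ! b"
  have "(kron J xs F * kron J xs F') $$ (a, b)
      = (\<Sum>c<length xs. (\<Prod>j\<in>J. F j (?x j) ((xs ! c) j)) * (\<Prod>j\<in>J. F' j ((xs ! c) j) (?y j)))"
    using ab by (simp add: kron_def scalar_prod_def lessThan_atLeast0)
  also have "\<dots> = (\<Sum>z\<in>set xs. (\<Prod>j\<in>J. F j (?x j) (z j)) * (\<Prod>j\<in>J. F' j (z j) (?y j)))"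
    using bij_betw_nth[OF xs(1) refl refl]
    by (rule sum.reindex_bij_betw)
  also have "\<dots> = (\<Sum>z\<in>Pi\<^sub>E J I. \<Prod>j\<in>J. F j (?x j) (z j) * F' j (z j) (?y j))"
    by (simp add: xs(2) prod.distrib)
  also have "\<dots> = (\<Prod>j\<in>J. \<Sum>z\<in>I j. F j (?x j) z * F' j z (?y j))"
    using finJ finI by (rule prod_sum_PiE[symmetric])
  also have "\<dots> = kron J xs (\<lambda>j. mmul (I j) (F j) (F' j)) $$ (a, b)"
    using ab by (simp add: kron_def mmul_def)
  finally show "(kron J xs F * kron J xs F') $$ (a, b)
      = kron J xs (\<lambda>j. mmul (I j) (F j) (F' j)) $$ (a, b)" .
qed (auto simp: kron_def)

lemma kron_add:
  assumes "i \<in> J"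
  shows "kron J xs (F(i := f + g)) = kron J xs (F(i := f)) + kron J xs (F(i := g))"
proof -
  have split: "(\<Prod>j\<in>J. (F(i := h)) j (x j) (y j))
      = h (x i) (y i) * (\<Prod>j\<in>J - {i}. F j (x j) (y j))" for h x y
    using finJ assms by (subst prod.remove[of J i]) (auto intro!: prod.cong arg_cong2[of _ _ _ _ "(*)"])
  show ?thesis
    by (rule eq_matI) (auto simp: kron_def split distrib_right simp del: fun_upd_apply)
qed

text \<open>
  Additivity in the factor \<open>i\<close> splits off the matrix \<open>X\<close> with the unit there. The matrix \<open>v\<close> is
  placed in the factor \<open>i\<close> of a Kronecker product of units and so commutes with \<open>X\<close>, whatever the
  other factors are; all of these go with \<open>u\<close>.
\<close>

lemma char_poly_kron_commute_factor:
  fixes F :: "'j \<Rightarrow> 'i \<Rightarrow> 'i \<Rightarrow> 'a::field_char_0"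
  assumes i: "i \<in> J"
  shows "char_poly (kron J xs (F(i := munit (I i) + mmul (I i) u v)))
       = char_poly (kron J xs (F(i := munit (I i) + mmul (I i) v u)))"
proof -
  let ?E = "\<lambda>j. munit (I j)"
  let ?X = "kron J xs (F(i := munit (I i)))"
  let ?U = "kron J xs (F(i := u))"
  let ?V = "kron J xs (?E(i := v))"
  have UV: "?U * ?V = kron J xs (F(i := mmul (I i) u v))"
    unfolding kron_mult by (rule kron_cong) (auto simp: mmul_munit finI)
  have VU: "?V * ?U = kron J xs (F(i := mmul (I i) v u))"
    unfolding kron_mult by (rule kron_cong) (auto simp: mmul_munit finI)
  have VX: "?V * ?X = ?X * ?V"
    unfolding kron_mult by (rule kron_cong) (auto simp: mmul_munit finI i)
  show ?thesis
    unfolding kron_add[OF i] UV[symmetric] VU[symmetric]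
    by (rule char_poly_add_mult_commute[OF kron_carrier kron_carrier kron_carrier VX])
qed

text \<open>
  Exchanging the factors one at a time: the set \<open>K\<close> in the proof consists of those already
  exchanged.
\<close>

lemma char_poly_kron_commute:
  fixes U V :: "'j \<Rightarrow> 'i \<Rightarrow> 'i \<Rightarrow> 'a::field_char_0"
  shows "char_poly (kron J xs (\<lambda>j. munit (I j) + mmul (I j) (U j) (V j)))
       = char_poly (kron J xs (\<lambda>j. munit (I j) + mmul (I j) (V j) (U j)))"
proof -
  let ?f = "\<lambda>j. munit (I j) + mmul (I j) (U j) (V j)"
  let ?g = "\<lambda>j. munit (I j) + mmul (I j) (V j) (U j)"
  have "char_poly (kron J xs (\<lambda>j. if j \<in> K then ?g j else ?f j)) = char_poly (kron J xs ?f)"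
    if "finite K" "K \<subseteq> J" for K
    using that
  proof (induction K)
    case (insert i K)
    let ?h = "\<lambda>j. if j \<in> K then ?g j else ?f j"
    have "(\<lambda>j. if j \<in> insert i K then ?g j else ?f j) = ?h(i := ?g i)" by auto
    moreover have "?h = ?h(i := ?f i)" using insert.hyps by auto
    ultimately show ?case
      using char_poly_kron_commute_factor[of i ?h "U i" "V i"] insert by auto
  qed simp
  from this[OF finJ order_refl]
  have "char_poly (kron J xs (\<lambda>j. if j \<in> J then ?g j else ?f j)) = char_poly (kron J xs ?f)" .
  moreover have "kron J xs (\<lambda>j. if j \<in> J then ?g j else ?f j) = kron J xs ?g"
    by (rule kron_cong) auto
  ultimately show ?thesis by simp
qed

end

section \<open>The connection matrix of a one-dimensional complex\<close>

text \<open>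
  The assumptions are the relations between the sign matrix \<open>S\<close>, the incidence matrix \<open>B\<close> and its
  transpose \<open>C\<close>. The squares of \<open>L\<close> and of its inverse \<open>N\<close> differ only in the order of the two
  matrices \<open>J N\<close> and \<open>J\<close>. Since \<open>- J\<^sup>2 = B C + C B\<close>, the equation \<open>L - N = - J\<^sup>2\<close> presents \<open>L - N\<close> as the
  sign-less Hodge Laplacian.
\<close>

lemma connection_relations:
  fixes S B C :: "'i \<Rightarrow> 'i \<Rightarrow> 'a::comm_ring_1"
  assumes SS: "mmul I S S = munit I"
    and SB: "mmul I S B = B" and BS: "mmul I B S = - B"
    and SC: "mmul I S C = - C" and CS: "mmul I C S = C"
    and BB: "mmul I B B = 0" and CC: "mmul I C C = 0"
  defines "L \<equiv> S + B + C + mmul I C B"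
    and "N \<equiv> S + B + C - mmul I B C"
    and "J \<equiv> B - C"
  shows "mmul I L N = munit I"
    and "mmul I L L = munit I + mmul I (mmul I J N) J"
    and "mmul I N N = munit I + mmul I J (mmul I J N)"
proof -
  \<comment> \<open>The relations inside right-nested products, so that rewriting reaches a normal form.\<close>
  have SBx: "mmul I S (mmul I B f) = mmul I B f"
    and SCx: "mmul I S (mmul I C f) = - mmul I C f"
    and BBx: "mmul I B (mmul I B f) = 0"
    and CCx: "mmul I C (mmul I C f) = 0" for f
    by (simp_all only: mmul_assoc[symmetric] SB SC BB CC mmul_linear)
  note rules = L_def N_def J_def mmul_assoc mmul_linear SS SB BS SC CS BB CC SBx SCx BBx CCx
  show "mmul I L N = munit I"
    and "mmul I L L = munit I + mmul I (mmul I J N) J"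
    and "mmul I N N = munit I + mmul I J (mmul I J N)"
    by (simp_all add: rules)
qed

definition dim_sign :: "'v set set \<Rightarrow> 'v set \<Rightarrow> 'v set \<Rightarrow> real" where
  "dim_sign K x y = (if x = y \<and> x \<in> K then if card x = 1 then 1 else - 1 else 0)"

definition face :: "'v set set \<Rightarrow> 'v set \<Rightarrow> 'v set \<Rightarrow> real" where
  "face K x y = (if x \<in> K \<and> y \<in> K \<and> x \<subset> y then 1 else 0)"

abbreviation coface :: "'v set set \<Rightarrow> 'v set \<Rightarrow> 'v set \<Rightarrow> real" where
  "coface K x y \<equiv> face K y x"

context
  fixes K :: "'v set set"
  assumes K: "finite_simplicial_complex K" "one_dimensional K"
begin

lemma finite_complex: "finite K"
  using K(1) by (simp add: finite_simplicial_complex_def)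

lemma face_in_complex: "x \<in> K \<Longrightarrow> y \<subseteq> x \<Longrightarrow> y \<noteq> {} \<Longrightarrow> y \<in> K"
  using K(1)[unfolded finite_simplicial_complex_def, THEN conjunct2, THEN conjunct2,
    THEN bspec, THEN spec, THEN mp] by simp

lemma card_simplex: "x \<in> K \<Longrightarrow> card x = 1 \<or> card x = 2"
  using K unfolding finite_simplicial_complex_def one_dimensional_def
  by (metis One_nat_def Suc_1 card_eq_0_iff le_SucE le_zero_eq)

lemma face_cards:
  assumes "x \<in> K" "y \<in> K" "x \<subset> y"
  shows "card x = 1" "card y = 2"
proof -
  have "finite y" using assms(2) K(1) by (auto simp: finite_simplicial_complex_def)
  then have "card x < card y" using assms(3) by (rule psubset_card_mono)
  then show "card x = 1" "card y = 2" using card_simplex[OF assms(1)] card_simplex[OF assms(2)] by auto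
qed

lemma mmul_dim_sign:
  "mmul K (dim_sign K) f x y = (if x \<in> K then if card x = 1 then f x y else - f x y else 0)"
  "mmul K f (dim_sign K) x y = (if y \<in> K then if card y = 1 then f x y else - f x y else 0)"
proof -
  have "mmul K (dim_sign K) f x y = (\<Sum>z\<in>K. if z = x then dim_sign K x x * f x y else 0)"
    unfolding mmul_def by (rule sum.cong) (auto simp: dim_sign_def)
  then show "mmul K (dim_sign K) f x y
      = (if x \<in> K then if card x = 1 then f x y else - f x y else 0)"
    using finite_complex by (simp add: dim_sign_def)
  have "mmul K f (dim_sign K) x y = (\<Sum>z\<in>K. if z = y then f x y * dim_sign K y y else 0)"
    unfolding mmul_def by (rule sum.cong) (auto simp: dim_sign_def)
  then show "mmul K f (dim_sign K) x y
      = (if y \<in> K then if card y = 1 then f x y else - f x y else 0)"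
    using finite_complex by (simp add: dim_sign_def)
qed

lemma sign_face_relations:
  "mmul K (dim_sign K) (dim_sign K) = munit K"
  "mmul K (dim_sign K) (face K) = face K"
  "mmul K (face K) (dim_sign K) = - face K"
  "mmul K (dim_sign K) (coface K) = - coface K"
  "mmul K (coface K) (dim_sign K) = coface K"
  "mmul K (face K) (face K) = 0"
  "mmul K (coface K) (coface K) = 0"
proof -
  show "mmul K (dim_sign K) (dim_sign K) = munit K"
    by (auto simp: fun_eq_iff mmul_dim_sign) (auto simp: dim_sign_def munit_def)
  show "mmul K (dim_sign K) (face K) = face K" "mmul K (face K) (dim_sign K) = - face K"
    "mmul K (dim_sign K) (coface K) = - coface K"
    "mmul K (coface K) (dim_sign K) = coface K"
    by (auto simp: fun_eq_iff mmul_dim_sign face_def dest: face_cards)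
  have chain: "face K x z * face K z y = 0" for x y z
  proof (rule ccontr)
    assume "face K x z * face K z y \<noteq> 0"
    then have "x \<in> K" "z \<in> K" "y \<in> K" "x \<subset> z" "z \<subset> y"
      unfolding face_def by (simp_all split: if_splits)
    from face_cards(2)[OF this(1,2,4)] face_cards(1)[OF this(2,3,5)] show False by simp
  qed
  then have chain': "face K z y * face K x z = 0" for x y z
    by (simp only: mult.commute)
  show "mmul K (face K) (face K) = 0" "mmul K (coface K) (coface K) = 0"
    by (simp_all only: mmul_def chain chain' sum.neutral_const zero_fun_def)
qed

text \<open>
  The proper faces of an edge are its vertices, so the proper faces shared by two edges are the
  singletons of their common points.
\<close>

lemma card_common_vertices:
  assumes x: "x \<in> K" "card x = 2" and y: "y \<in> K" "card y = 2"
  shows "mmul K (coface K) (face K) x y = card (x \<inter> y)"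
proof -
  have "{z \<in> K. z \<subset> x \<and> z \<subset> y} = (\<lambda>v. {v}) ` (x \<inter> y)"
  proof (rule equalityI; rule subsetI)
    fix z assume z: "z \<in> {z \<in> K. z \<subset> x \<and> z \<subset> y}"
    then have "card z = 1" using face_cards(1)[of z x] x by auto
    then show "z \<in> (\<lambda>v. {v}) ` (x \<inter> y)" using z by (auto simp: card_1_singleton_iff)
  next
    fix z assume "z \<in> (\<lambda>v. {v}) ` (x \<inter> y)"
    then obtain v where v: "z = {v}" "v \<in> x" "v \<in> y" by auto
    have "{v} \<subseteq> x" "{v} \<noteq> {}" using v by auto
    then have "z \<in> K" unfolding v(1) by (rule face_in_complex[OF x(1)])
    moreover have "z \<noteq> x" "z \<noteq> y" using v x y by auto
    ultimately show "z \<in> {z \<in> K. z \<subset> x \<and> z \<subset> y}" using v by auto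
  qed
  moreover have "mmul K (coface K) (face K) x y = (\<Sum>z\<in>K. if z \<subset> x \<and> z \<subset> y then 1 else 0)"
    unfolding mmul_def by (rule sum.cong) (auto simp: face_def x y)
  moreover have "\<dots> = card {z \<in> K. z \<subset> x \<and> z \<subset> y}"
    using finite_complex by (simp add: sum.If_cases Int_def)
  ultimately show ?thesis by (simp add: card_image)
qed

text \<open>
  For two distinct edges the last summand counts their common vertices, of which there is at most
  one. For an edge with itself it counts \<open>2\<close>, which the sign \<open>-1\<close> corrects to \<open>1\<close>. In all other
  cases it vanishes, and the two simplices meet iff they are equal or one contains the other.
\<close>

lemma connection_decomposition:
  assumes x: "x \<in> K" and y: "y \<in> K"
  shows "(if x \<inter> y \<noteq> {} then 1 else 0)
       = (dim_sign K + face K + coface K + mmul K (coface K) (face K)) x y"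
proof (cases "card x = 2 \<and> card y = 2")
  case True
  then have fin: "finite x" "finite y" by (auto intro: card_ge_0_finite)
  have "\<not> x \<subset> y" "\<not> y \<subset> x" using face_cards(1)[OF x y] face_cards(1)[OF y x] True by linarith+
  then have nf: "face K x y = 0" "face K y x = 0" by (simp_all add: face_def)
  show ?thesis
  proof (cases "x = y")
    case eq: True
    then have "x \<inter> y \<noteq> {}" using True by auto
    then show ?thesis using True eq x nf card_common_vertices[OF x _ y] by (simp add: dim_sign_def)
  next
    case neq: False
    have "card (x \<inter> y) < 2"
    proof (rule ccontr)
      assume "\<not> card (x \<inter> y) < 2"
      then have ge: "2 \<le> card (x \<inter> y)" by simp
      have "x \<inter> y = x" by (rule card_seteq) (use fin True ge in simp_all)
      moreover have "x \<inter> y = y" by (rule card_seteq) (use fin True ge in simp_all)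
      ultimately show False using neq by simp
    qed
    then have "card (x \<inter> y) = (if x \<inter> y \<noteq> {} then 1 else 0)"
      using fin by (cases "card (x \<inter> y)") auto
    then show ?thesis using True neq nf card_common_vertices[OF x _ y] by (simp add: dim_sign_def)
  qed
next
  case False
  then have "mmul K (coface K) (face K) x y = 0"
    using x y by (auto simp: mmul_def face_def intro!: sum.neutral dest: face_cards(2))
  moreover have "(if x \<inter> y \<noteq> {} then 1 else 0) = dim_sign K x y + face K x y + face K y x"
  proof -
    have vertex_edge: "(if v \<inter> e \<noteq> {} then 1 else 0) = face K v e" "dim_sign K v e = 0"
      "dim_sign K e v = 0" "face K e v = 0"
      if v: "v \<in> K" "card v = 1" and e: "e \<in> K" "card e = 2" for v e
    proof -
      have "v \<noteq> e" "\<not> e \<subset> v" using face_cards(1)[of e v] v e by auto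
      moreover obtain a where "v = {a}" using v(2) card_1_singletonE by blast
      ultimately show "(if v \<inter> e \<noteq> {} then 1 else 0) = face K v e" "dim_sign K v e = 0"
        "dim_sign K e v = 0" "face K e v = 0"
        using v e by (simp_all add: face_def dim_sign_def psubset_eq)
    qed
    consider "card x = 1" "card y = 1" | "card x = 1" "card y = 2" | "card x = 2" "card y = 1"
      using False card_simplex[OF x] card_simplex[OF y] by blast
    then show ?thesis
    proof cases
      case 1
      then obtain a b where "x = {a}" "y = {b}" using card_1_singletonE by metis
      then show ?thesis using x y by (simp add: dim_sign_def face_def psubset_eq)
    next
      case 2
      then show ?thesis using vertex_edge[of x y] x y by simp
    next
      case 3
      then show ?thesis using vertex_edge[of y x] x y by (simp add: Int_commute)
    qed
  qed
  ultimately show ?thesis by simp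
qed

end

section \<open>The functional equation\<close>

theorem corollary3:
  fixes m :: nat and G :: "nat \<Rightarrow> 'v set set" and xs :: "(nat \<Rightarrow> 'v set) list"
    and L :: "real mat"
  assumes "m \<ge> 1"
    and "\<And>j. j \<in> {1..m} \<Longrightarrow> finite_simplicial_complex (G j)"
    and "\<And>j. j \<in> {1..m} \<Longrightarrow> one_dimensional (G j)"
    and "distinct xs" and "set xs = complex_product m G"
    and "L = connection_laplacian m xs"
  shows "\<forall>s::complex. spectral_zeta (L ^\<^sub>m 2) (- s) = spectral_zeta (L ^\<^sub>m 2) s"
proof
  fix s :: complex
  let ?n = "length xs"
  let ?kron = "kron {1..m} xs"
  have G: "finite_simplicial_complex (G j)" "one_dimensional (G j)" if "j \<in> {1..m}" for j
    using assms(2,3) that by auto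
  have xs: "set xs = Pi\<^sub>E {1..m} G" using assms(5) by (simp add: complex_product_def)
  have fin: "finite (G j)" if "j \<in> {1..m}" for j
    using G[OF that] by (rule finite_complex)
  interpret finite_product "{1..m}" G xs
    using fin assms(4) xs by unfold_locales simp_all
  define l where "l j = dim_sign (G j) + face (G j) + coface (G j)
    + mmul (G j) (coface (G j)) (face (G j))" for j
  define l' where "l' j = dim_sign (G j) + face (G j) + coface (G j)
    - mmul (G j) (face (G j)) (coface (G j))" for j
  define d where "d j = face (G j) - coface (G j)" for j
  define N where "N = ?kron l'"
  note rel = connection_relations[OF sign_face_relations[OF G], folded l_def l'_def d_def]
  \<comment> \<open>An indicator of a conjunction over the factors is a product of indicators.\<close>
  have L: "L = ?kron l"
  proof -
    have "L = ?kron (\<lambda>j x y. if x \<inter> y \<noteq> {} then 1 else 0)"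
      unfolding assms(6) connection_laplacian_def kron_def
      by (intro cong_mat) auto
    also have "\<dots> = ?kron l"
      unfolding l_def by (rule kron_cong) (auto simp only: connection_decomposition[OF G])
    finally show ?thesis .
  qed
  have carrier: "L \<in> carrier_mat ?n ?n" "N \<in> carrier_mat ?n ?n" by (simp_all add: L N_def)
  have LN: "L * N = 1\<^sub>m ?n"
    unfolding L N_def kron_mult kron_munit[symmetric]
    by (rule kron_cong) (simp_all add: rel)
  have LL: "L * L = ?kron (\<lambda>j. munit (G j) + mmul (G j) (mmul (G j) (d j) (l' j)) (d j))"
    unfolding L kron_mult
    by (rule kron_cong) (simp_all only: rel)
  have NN: "N * N = ?kron (\<lambda>j. munit (G j) + mmul (G j) (d j) (mmul (G j) (d j) (l' j)))"
    unfolding N_def kron_mult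
    by (rule kron_cong) (simp_all only: rel)
  have char: "char_poly (L * L) = char_poly (N * N)"
    unfolding LL NN by (rule char_poly_kron_commute)
  have sym: "L\<^sup>T = L"
    unfolding assms(6) connection_laplacian_def by (intro eq_matI) (auto simp: Int_commute)
  have det: "det L \<noteq> 0" using det_mult[OF carrier] LN by auto
  have inv: "(L * L) * (N * N) = 1\<^sub>m ?n"
  proof -
    have "(L * L) * (N * N) = L * ((L * N) * N)"
      using carrier by (simp add: assoc_mult_mat[of _ ?n ?n _ ?n _ ?n])
    then show ?thesis using carrier LN by simp
  qed
  have "spectral_zeta (L * L) (- s) = spectral_zeta (L * L) s"
    using carrier inv char eigenvalue_square_pos[OF carrier(1) sym det]
    by (intro spectral_zeta_functional_equation[of _ ?n "N * N"]) auto
  moreover have "L ^\<^sub>m 2 = L * L" using carrier by (simp add: numeral_2_eq_2)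
  ultimately show "spectral_zeta (L ^\<^sub>m 2) (- s) = spectral_zeta (L ^\<^sub>m 2) s" by simp
qed

end
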